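(* Let $f(t)=\sum_{j=1}^n \mu_j e^{-i\lambda_j t}$ be a finite sum of oscillating exponentials with real frequencies $\lambda_j>0$ and coefficients $\mu_j\in\mathbb{C}$, and let $\epsilon>0$. The condition $|f(t)|<\epsilon$ for all $t\in[0,2\pi/\min_j\{\lambda_j\}]$ is not sufficient to ensure that $|f(t)|<\epsilon$ for all $t\in[0,\infty)$. That is, there exist $\epsilon>0$, $n\in\mathbb{N}$, frequencies $\lambda_1,\dots,\lambda_n>0$ and coefficients $\mu_1,\dots,\mu_n\in\mathbb{C}$ such that $|f(t)|<\epsilon$ for all $t\in[0,2\pi/\min_j\{\lambda_j\}]$, but $|f(t)|\geq\epsilon$ for some $t\in[0,\infty)$.
   Context: Here $i$ is the imaginary unit. The functions $f$ model the components of a vector $\varrho(t)=e^{-iLt}\varrho_0$, with $L$ a Hermitian matrix; by diagonalizing $L$, each component is a finite linear combination of the oscillators $e^{-i\lambda_j t}$ with $\lambda_j$ in the spectrum of $L$. *)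

theory Defs
  imports Complex_Main
begin

definition osc_sum :: "nat \<Rightarrow> (nat \<Rightarrow> complex) \<Rightarrow> (nat \<Rightarrow> real) \<Rightarrow> real \<Rightarrow> complex" where
  "osc_sum n \<mu> lam t = (\<Sum>j=1..n. \<mu> j * exp (- \<i> * complex_of_real (lam j) * complex_of_real t))"

end

theory Submission
  imports Defs
begin

text \<open>Two oscillators of nearby frequencies beat slowly: \<open>\<bar>exp (-\<i>t) - exp (-5\<i>t/4)\<bar> = 2 \<bar>sin (t/8)\<bar>\<close>
  is at most \<open>\<surd>2\<close> over the period \<open>[0, 2\<pi>]\<close> of the slower oscillator, but reaches \<open>2\<close> at \<open>t = 4\<pi>\<close>.\<close>

text \<open>Law of cosines for two unit vectors. The squared form avoids roots and half angles, so
  bounding the beat reduces to bounding one cosine.\<close>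

lemma cmod_cis_diff_squared: "(cmod (cis a - cis b))\<^sup>2 = 2 - 2 * cos (a - b)"
proof -
  have "(cmod (cis a - cis b))\<^sup>2 = (cos a - cos b)\<^sup>2 + (sin a - sin b)\<^sup>2"
    by (simp add: cmod_power2)
  also have "\<dots> = ((sin a)\<^sup>2 + (cos a)\<^sup>2) + ((sin b)\<^sup>2 + (cos b)\<^sup>2) - 2 * (cos a * cos b + sin a * sin b)"
    by (simp add: power2_eq_square algebra_simps)
  also have "\<dots> = 2 - 2 * cos (a - b)"
    by (simp only: sin_cos_squared_add cos_diff)
  finally show ?thesis .
qed

theorem mainTheorem1:
  shows "\<exists>(\<epsilon>::real) (n::nat) (lam :: nat \<Rightarrow> real) (\<mu> :: nat \<Rightarrow> complex).
    \<epsilon> > 0 \<and> n \<ge> 1 \<and> (\<forall>j\<in>{1..n}. lam j > 0) \<and>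
    (\<forall>t\<in>{0..2 * pi / Min (lam ` {1..n})}. cmod (osc_sum n \<mu> lam t) < \<epsilon>) \<and>
    (\<exists>t\<in>{0..}. cmod (osc_sum n \<mu> lam t) \<ge> \<epsilon>)"
proof -
  \<comment> \<open>The frequency gap 1/4 gives the phase difference t/4. With opposite coefficients
    the two terms cancel at t = 0 and align once that difference reaches pi.\<close>
  define lam :: "nat \<Rightarrow> real" where "lam j = (if j = 1 then 1 else 5/4)" for j
  define \<mu> :: "nat \<Rightarrow> complex" where "\<mu> j = (if j = 1 then 1 else -1)" for j
  have interval: "{1..2::nat} = {1, 2}"
    by auto
  have Min_lam: "Min (lam ` {1..2}) = 1"
    unfolding interval by (simp add: lam_def)
  have beat: "(cmod (osc_sum 2 \<mu> lam t))\<^sup>2 = 2 - 2 * cos (t / 4)" for t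
  proof -
    have "osc_sum 2 \<mu> lam t = cis (- t) - cis (- (5/4 * t))"
      unfolding osc_sum_def interval by (simp add: \<mu>_def lam_def cis_conv_exp mult.assoc)
    then show ?thesis
      by (simp add: cmod_cis_diff_squared)
  qed
  have "cmod (osc_sum 2 \<mu> lam t) < 2" if "t \<in> {0..2 * pi}" for t
  proof -
    \<comment> \<open>Here t/4 lies in [0, pi/2], so the squared modulus is at most 2, below
      4.\<close>
    have "cos (t / 4) \<ge> 0"
      using that by (intro cos_ge_zero) auto
    then have "(cmod (osc_sum 2 \<mu> lam t))\<^sup>2 < 2\<^sup>2"
      by (simp add: beat)
    then show ?thesis
      by (rule power2_less_imp_less) simp
  qed
  \<comment> \<open>Since cos pi = -1, the squared modulus is exactly 4: the trivial bound 1 + 1 is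
    attained.\<close>
  moreover have "cmod (osc_sum 2 \<mu> lam (4 * pi)) \<ge> 2"
    by (rule power2_le_imp_le) (simp_all add: beat)
  moreover have "4 * pi \<in> {0..}"
    by simp
  moreover have "\<forall>j\<in>{1..2}. lam j > 0"
    by (simp add: lam_def)
  ultimately show ?thesis
    using Min_lam
    by (intro exI[of _ 2] exI[of _ "2::nat"] exI[of _ lam] exI[of _ \<mu>]) auto
qed

end
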